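(* Let $r\ge 1$ be an integer, let $u\in\mathbb{C}$ be algebraic with $|u|<1$, and let $w,w_1,\ldots,w_r,v_1,\ldots,v_r$ be complex numbers with positive real parts. Let $\zeta_q^{(r)}(s,w,u|w_1,\ldots,w_r;v_1,\ldots,v_r)$ be the multiple Changhee $q$-zeta function and $H^{(r)}_{n,q}(u^{-1},w|w_1,\ldots,w_r;v_1,\ldots,v_r)$ the multiple Changhee $q$-Euler polynomials, as defined in the context. Then for every positive integer $n$, $$\zeta_q^{(r)}(-n,w,u|w_1,\ldots,w_r;v_1,\ldots,v_r)=\frac{1}{(1-u)^r}H^{(r)}_{n,q}(u^{-1},w|w_1,\ldots,w_r;v_1,\ldots,v_r).$$
   Context: Here $q\in\mathbb{C}$ with $0<|q|<1$ and $u\neq 0$. Choices of $\log q$ and $\log u$ are fixed, $q^z=\exp(z\log q)$, $u^z=\exp(z\log u)$, and $[z]_q=\frac{1-q^z}{1-q}$ for $z\in\mathbb{C}$. The parameters are assumed to be such that the series below converge absolutely: $|u^{v_j}|<1$ and $|q^{w_j}|<1$ for $j=1,\ldots,r$ (the latter is automatic when $q\in(0,1)$ with real logarithm). The multiple Changhee $q$-zeta function is defined, for $s\in\mathbb{C}$, by $$\zeta_q^{(r)}(s,w,u|w_1,\ldots,w_r;v_1,\ldots,v_r)=\sum_{n_1,\ldots,n_r=0}^{\infty}\frac{u^{\sum_{i=1}^r v_i n_i}}{\left[w+n_1w_1+\cdots+n_rw_r\right]_q^{s}}$$ (at $s=-n$ the terms are $u^{\sum_i v_i n_i}[w+n_1w_1+\cdots+n_rw_r]_q^{n}$).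 The multiple Changhee $q$-Euler polynomials $H^{(r)}_{n,q}(u^{-1},w|w_1,\ldots,w_r;v_1,\ldots,v_r)$, $n\ge 0$, are defined by the generating function $$(1-u)^r\sum_{n_1,\ldots,n_r=0}^{\infty}u^{\sum_{i=1}^r n_i v_i}\,e^{\left[w+\sum_{i=1}^r n_i w_i\right]_q t}=\sum_{n=0}^{\infty}H^{(r)}_{n,q}(u^{-1},w|w_1,\ldots,w_r;v_1,\ldots,v_r)\frac{t^n}{n!}.$$ *)

theory Defs
  imports "HOL-Analysis.Analysis" "HOL-Computational_Algebra.Polynomial"
begin

text \<open>
  The bases \<open>q\<close> and \<open>u\<close> enter only together with a fixed choice of their logarithms, so the
  definitions take the logarithms \<open>lq\<close> and \<open>lu\<close> as arguments, with \<open>q = exp lq\<close> and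
  \<open>u = exp lu\<close>.
\<close>

definition base_power :: "complex \<Rightarrow> complex \<Rightarrow> complex" where
  "base_power l z = exp (z * l)"

definition q_bracket :: "complex \<Rightarrow> complex \<Rightarrow> complex" where
  "q_bracket lq z = (1 - base_power lq z) / (1 - exp lq)"

text \<open>
  Multi-indices \<open>(n\<^sub>1, \<dots>, n\<^sub>r)\<close> are the extensional functions on \<open>{1..r}\<close>; the multiple
  series are unordered sums over them, which for complex terms means absolute convergence.
\<close>

definition multi_indices :: "nat \<Rightarrow> (nat \<Rightarrow> nat) set" where
  "multi_indices r = ({1..r} \<rightarrow>\<^sub>E UNIV)"

text \<open>
  The complex power of the bracket is the principal one. The choice of branch does not matter at
  \<open>s = - n\<close>; see the lemma below, which also covers brackets that vanish.
\<close>

definition changhee_q_zeta ::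
  "complex \<Rightarrow> complex \<Rightarrow> nat \<Rightarrow> complex \<Rightarrow> complex \<Rightarrow> (nat \<Rightarrow> complex) \<Rightarrow> (nat \<Rightarrow> complex) \<Rightarrow> complex"
where
  "changhee_q_zeta lq lu r s w ws vs =
     (\<Sum>\<^sub>\<infinity>k\<in>multi_indices r.
        base_power lu (\<Sum>i=1..r. vs i * of_nat (k i)) /
        q_bracket lq (w + (\<Sum>i=1..r. of_nat (k i) * ws i)) powr s)"

lemma divide_powr_minus_of_nat:
  fixes c x :: complex
  assumes "n > 0"
  shows "c / x powr (- of_nat n) = c * x ^ n"
  using assms by (cases "x = 0") (auto simp: powr_minus powr_nat' divide_simps)

definition changhee_q_euler_gen ::
  "complex \<Rightarrow> complex \<Rightarrow> nat \<Rightarrow> complex \<Rightarrow> (nat \<Rightarrow> complex) \<Rightarrow> (nat \<Rightarrow> complex) \<Rightarrow> complex \<Rightarrow> complex"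
where
  "changhee_q_euler_gen lq lu r w ws vs t =
     (1 - exp lu) ^ r *
     (\<Sum>\<^sub>\<infinity>k\<in>multi_indices r.
        base_power lu (\<Sum>i=1..r. of_nat (k i) * vs i) *
        exp (q_bracket lq (w + (\<Sum>i=1..r. of_nat (k i) * ws i)) * t))"

text \<open>
  \<open>changhee_q_euler lq lu r n w ws vs\<close> is the polynomial usually written with first argument
  \<open>u\<^sup>-\<^sup>1\<close>, where \<open>u = exp lu\<close>. The generating function is entire in \<open>t\<close> when
  \<open>\<bar>u\<^bsup>v\<^sub>j\<^esup>\<bar> < 1\<close> and \<open>\<bar>q\<^bsup>w\<^sub>j\<^esup>\<bar> < 1\<close> for all \<open>j\<close>, since the brackets are then bounded;
  hence its expansion is required for every \<open>t\<close>.
\<close>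

definition changhee_q_euler ::
  "complex \<Rightarrow> complex \<Rightarrow> nat \<Rightarrow> nat \<Rightarrow> complex \<Rightarrow> (nat \<Rightarrow> complex) \<Rightarrow> (nat \<Rightarrow> complex) \<Rightarrow> complex"
where
  "changhee_q_euler lq lu r n w ws vs =
     (THE h. \<forall>t. (\<lambda>m. h m * t ^ m / fact m) sums changhee_q_euler_gen lq lu r w ws vs t) n"

end

theory Submission
  imports Defs
begin

text \<open>
  The brackets in the series are bounded and the weights \<open>u\<^bsup>\<Sum> v\<^sub>i n\<^sub>i\<^esup>\<close> are absolutely summable,
  being products of geometric progressions. So in the generating function the exponentials may be
  expanded and the sums interchanged; the coefficient of \<open>t\<^sup>n / n!\<close> is the series defining the zeta
  value, up to the factor \<open>(1 - u)\<^sup>r\<close>.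
\<close>

text \<open>For nonnegative terms it suffices to bound the finite partial sums. A finite set of
  functions lies in a finite box, over which the sum of products factors into a product of finite
  sums, each at most the corresponding infinite sum.\<close>

lemma summable_on_prod_PiE_real:
  fixes f :: "'a \<Rightarrow> 'b \<Rightarrow> real"
  assumes "finite A"
    and f: "\<And>x. x \<in> A \<Longrightarrow> f x summable_on B x"
    and nonneg: "\<And>x y. x \<in> A \<Longrightarrow> y \<in> B x \<Longrightarrow> f x y \<ge> 0"
  shows "(\<lambda>g. \<Prod>x\<in>A. f x (g x)) summable_on PiE A B"
proof (rule nonneg_bdd_above_summable_on)
  show "0 \<le> (\<Prod>x\<in>A. f x (g x))" if "g \<in> PiE A B" for g
    using that nonneg by (intro prod_nonneg) auto
  show "bdd_above (sum (\<lambda>g. \<Prod>x\<in>A. f x (g x)) ` {F. F \<subseteq> PiE A B \<and> finite F})"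
  proof (rule bdd_aboveI2)
    fix F assume "F \<in> {F. F \<subseteq> PiE A B \<and> finite F}"
    then have F: "F \<subseteq> PiE A B" "finite F" by auto
    \<comment> \<open>\<open>C x\<close> collects the values at \<open>x\<close> of the functions in
      \<open>F\<close>, so that \<open>PiE A C\<close> is a finite box around
      \<open>F\<close>.\<close>
    define C where "C x = (\<lambda>g. g x) ` F" for x
    have C: "finite (C x)" for x
      using F by (simp add: C_def)
    have CB: "C x \<subseteq> B x" if "x \<in> A" for x
      using F that by (auto simp: C_def)
    have "F \<subseteq> PiE A C"
    proof
      fix g assume "g \<in> F"
      with F(1) have "g \<in> extensional A" by (auto simp: PiE_def)
      with \<open>g \<in> F\<close> show "g \<in> PiE A C" by (auto simp: PiE_def C_def)
    qed
    then have "(\<Sum>g\<in>F. \<Prod>x\<in>A. f x (g x)) \<le> (\<Sum>g\<in>PiE A C. \<Prod>x\<in>A. f x (g x))"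
      using C CB nonneg \<open>finite A\<close>
      by (intro sum_mono2 finite_PiE prod_nonneg) (auto simp: PiE_iff subset_iff)
    also have "\<dots> = (\<Prod>x\<in>A. \<Sum>y\<in>C x. f x y)"
      using C \<open>finite A\<close> by (simp add: prod_sum_PiE)
    also have "\<dots> \<le> (\<Prod>x\<in>A. infsum (f x) (B x))"
      using C CB nonneg f
      by (intro prod_mono conjI sum_nonneg finite_sum_le_infsum) (auto simp: subset_iff)
    finally show "(\<Sum>g\<in>F. \<Prod>x\<in>A. f x (g x)) \<le> (\<Prod>x\<in>A. infsum (f x) (B x))" .
  qed
qed

text \<open>Convergence at every \<open>t\<close> makes the radius infinite, so equality of the sums
  passes to the formal power series. This is the uniqueness behind the \<open>THE\<close> in
  \<open>changhee_q_euler\<close>.\<close>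

lemma powser_sums_unique:
  fixes a b :: "nat \<Rightarrow> complex"
  assumes a: "\<And>t. (\<lambda>n. a n * t ^ n) sums f t" and b: "\<And>t. (\<lambda>n. b n * t ^ n) sums f t"
  shows "a = b"
proof -
  have "fps_conv_radius (Abs_fps c) = \<infinity>" if "\<And>t. (\<lambda>n. c n * t ^ n) sums f t" for c
    unfolding fps_conv_radius_def using that by (intro conv_radius_inftyI'') (auto simp: sums_iff)
  with a b have "Abs_fps a = Abs_fps b"
    by (intro eval_fps_eqD) (auto simp: eval_fps_def sums_iff)
  then show ?thesis
    by (simp add: fps_eq_iff fun_eq_iff)
qed

text \<open>Absolute convergence lets the ordered exponential series be read as an unordered sum,
  the form in which sums can be interchanged.\<close>

lemma has_sum_exp:
  fixes y :: "'a :: {banach, real_normed_field}"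
  shows "((\<lambda>m. y ^ m / fact m) has_sum exp y) UNIV"
proof -
  have eq: "y ^ m / fact m = y ^ m /\<^sub>R fact m" for m
    by (simp add: scaleR_conv_of_real field_simps)
  show ?thesis
    unfolding eq by (intro norm_summable_imp_has_sum exp_converges summable_norm_exp)
qed

text \<open>Fubini for the double series obtained by expanding each exponential: the uniform bound
  on the \<open>x k\<close> gives a summable majorant on \<open>A \<times> UNIV\<close>.\<close>

lemma sums_infsum_times_exp:
  fixes c x :: "'a \<Rightarrow> complex"
  assumes c: "(\<lambda>k. norm (c k)) summable_on A" and x: "\<And>k. k \<in> A \<Longrightarrow> norm (x k) \<le> B"
  shows "(\<lambda>m. (\<Sum>\<^sub>\<infinity>k\<in>A. c k * x k ^ m) * t ^ m / fact m) sums
           (\<Sum>\<^sub>\<infinity>k\<in>A. c k * exp (x k * t))"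
proof -
  define F where "F k m = c k * (x k * t) ^ m / fact m" for k and m :: nat
  \<comment> \<open>The absolute value keeps the majorant nonnegative for every real
    \<open>B\<close>; a negative \<open>B\<close> can occur when \<open>A\<close> is empty.\<close>
  define G where "G k m = norm (c k) * ((\<bar>B\<bar> * norm t) ^ m / fact m)" for k and m :: nat
  have G: "(case_prod G) summable_on A \<times> UNIV"
  proof (rule summable_on_SigmaI)
    show "((\<lambda>m. case_prod G (k, m)) has_sum norm (c k) * exp (\<bar>B\<bar> * norm t)) UNIV" for k
      using has_sum_cmult_right[OF has_sum_exp] by (simp add: G_def)
    show "(\<lambda>k. norm (c k) * exp (\<bar>B\<bar> * norm t)) summable_on A"
      using c by (rule summable_on_cmult_left)
  qed (auto simp: G_def)
  have "norm (F k m) \<le> G k m" if "k \<in> A" for k m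
  proof -
    have "norm (x k) \<le> \<bar>B\<bar>"
      using x[OF that] by linarith
    then have "(norm (x k) * norm t) ^ m \<le> (\<bar>B\<bar> * norm t) ^ m"
      by (intro power_mono mult_right_mono) auto
    then show ?thesis
      by (auto simp: F_def G_def norm_mult norm_divide norm_power
          intro!: mult_left_mono divide_right_mono)
  qed
  then have "(\<lambda>z. norm (case_prod F z)) summable_on A \<times> UNIV"
    by (intro Infinite_Sum.abs_summable_on_comparison_test'[OF G]) auto
  then have F: "case_prod F summable_on A \<times> UNIV"
    by (rule abs_summable_summable)
  have rows: "(F k has_sum c k * exp (x k * t)) UNIV" for k
    using has_sum_cmult_right[OF has_sum_exp, of "c k" "x k * t"] by (simp add: F_def[abs_def])
  \<comment> \<open>The conclusion is a series in \<open>m\<close>, so \<open>m\<close> has to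
    become the outer index.\<close>
  have F': "(\<lambda>(m, k). F k m) summable_on UNIV \<times> A"
    using F by (subst (asm) summable_on_swap) simp
  have "((\<lambda>m. \<Sum>\<^sub>\<infinity>k\<in>A. F k m) has_sum (\<Sum>\<^sub>\<infinity>m. \<Sum>\<^sub>\<infinity>k\<in>A. F k m)) UNIV"
    using summable_on_Sigma_banach[OF F'] by (intro has_sum_infsum)
  also have "(\<Sum>\<^sub>\<infinity>m. \<Sum>\<^sub>\<infinity>k\<in>A. F k m) = (\<Sum>\<^sub>\<infinity>k\<in>A. \<Sum>\<^sub>\<infinity>m. F k m)"
    using infsum_swap_banach[OF F] by simp
  also have "\<dots> = (\<Sum>\<^sub>\<infinity>k\<in>A. c k * exp (x k * t))"
    using rows by (intro infsum_cong infsumI)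
  also have "(\<lambda>m. \<Sum>\<^sub>\<infinity>k\<in>A. F k m) = (\<lambda>m. (\<Sum>\<^sub>\<infinity>k\<in>A. c k * x k ^ m) * t ^ m / fact m)"
  proof
    fix m
    have "(\<Sum>\<^sub>\<infinity>k\<in>A. F k m) = (\<Sum>\<^sub>\<infinity>k\<in>A. (c k * x k ^ m) * (t ^ m / fact m))"
      by (simp add: F_def power_mult_distrib mult.assoc)
    also have "\<dots> = (\<Sum>\<^sub>\<infinity>k\<in>A. c k * x k ^ m) * (t ^ m / fact m)"
      by (rule infsum_cmult_left')
    finally show "(\<Sum>\<^sub>\<infinity>k\<in>A. F k m) = (\<Sum>\<^sub>\<infinity>k\<in>A. c k * x k ^ m) * t ^ m / fact m"
      by simp
  qed
  finally show ?thesis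
    by (rule has_sum_imp_sums)
qed

lemma base_power_add: "base_power l (a + b) = base_power l a * base_power l b"
  by (simp add: base_power_def distrib_right exp_add)

lemma base_power_sum:
  assumes "finite A"
  shows "base_power l (\<Sum>i\<in>A. of_nat (k i) * a i) = (\<Prod>i\<in>A. base_power l (a i) ^ k i)"
  using assms by (simp add: base_power_def sum_distrib_right exp_sum exp_of_nat_mult mult.assoc)

lemma summable_on_norm_base_power:
  assumes "\<And>j. j \<in> {1..r} \<Longrightarrow> norm (base_power l (a j)) < 1"
  shows "(\<lambda>k. norm (base_power l (\<Sum>i=1..r. of_nat (k i) * a i))) summable_on multi_indices r"
proof -
  \<comment> \<open>One geometric series per coordinate; by \<open>base_power_sum\<close> the norm
    of the weight is the product of their terms.\<close>
  have "(\<lambda>m. norm (base_power l (a j)) ^ m) summable_on UNIV" if "j \<in> {1..r}" for j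
    using assms[OF that] by (intro norm_summable_imp_summable_on) (simp add: norm_power)
  then show ?thesis
    unfolding multi_indices_def
    using summable_on_prod_PiE_real[of "{1..r}" "\<lambda>j m. norm (base_power l (a j)) ^ m" "\<lambda>_. UNIV"]
    by (simp add: base_power_sum prod_norm [symmetric] norm_power)
qed

text \<open>Shifting \<open>w\<close> by the \<open>ws i\<close> multiplies its power of
  \<open>q\<close> by factors of modulus at most 1, so the numerator is bounded uniformly in
  \<open>k\<close>.\<close>

lemma norm_q_bracket_le:
  fixes r :: nat
  assumes "\<And>j. j \<in> {1..r} \<Longrightarrow> norm (base_power lq (ws j)) < 1"
  shows "norm (q_bracket lq (w + (\<Sum>i=1..r. of_nat (k i) * ws i))) \<le>
           (1 + norm (base_power lq w)) / norm (1 - exp lq)"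
proof -
  have "(\<Prod>i=1..r. norm (base_power lq (ws i)) ^ k i) \<le> 1"
    using assms by (intro prod_le_1 conjI power_le_one) (auto intro: less_imp_le)
  then have "norm (base_power lq (w + (\<Sum>i=1..r. of_nat (k i) * ws i))) \<le> norm (base_power lq w)"
    unfolding base_power_add base_power_sum[OF finite_atLeastAtMost] norm_mult
      prod_norm [symmetric] norm_power
    by (intro mult_left_le) auto
  then have "norm (1 - base_power lq (w + (\<Sum>i=1..r. of_nat (k i) * ws i))) \<le>
      1 + norm (base_power lq w)"
    using norm_triangle_ineq4[of 1 "base_power lq (w + (\<Sum>i=1..r. of_nat (k i) * ws i))"] by simp
  \<comment> \<open>If \<open>exp lq = 1\<close>, both sides are 0 by the convention for division by
    zero.\<close>
  then show ?thesis
    by (simp add: q_bracket_def norm_divide divide_right_mono)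
qed

text \<open>The \<open>THE\<close> in \<open>changhee_q_euler\<close> gets existence from
  \<open>sums_infsum_times_exp\<close> and uniqueness from
  \<open>powser_sums_unique\<close>.\<close>

lemma changhee_q_euler_eq:
  assumes "\<And>j. j \<in> {1..r} \<Longrightarrow> norm (base_power lu (vs j)) < 1"
    and "\<And>j. j \<in> {1..r} \<Longrightarrow> norm (base_power lq (ws j)) < 1"
  shows "changhee_q_euler lq lu r n w ws vs =
    (1 - exp lu) ^ r *
    (\<Sum>\<^sub>\<infinity>k\<in>multi_indices r.
       base_power lu (\<Sum>i=1..r. of_nat (k i) * vs i) *
       q_bracket lq (w + (\<Sum>i=1..r. of_nat (k i) * ws i)) ^ n)"
proof -
  define h where "h m = (1 - exp lu) ^ r *
    (\<Sum>\<^sub>\<infinity>k\<in>multi_indices r.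
       base_power lu (\<Sum>i=1..r. of_nat (k i) * vs i) *
       q_bracket lq (w + (\<Sum>i=1..r. of_nat (k i) * ws i)) ^ m)" for m
  have h: "(\<lambda>m. h m * t ^ m / fact m) sums changhee_q_euler_gen lq lu r w ws vs t" for t
  proof -
    have "(\<lambda>m. (\<Sum>\<^sub>\<infinity>k\<in>multi_indices r.
             base_power lu (\<Sum>i=1..r. of_nat (k i) * vs i) *
             q_bracket lq (w + (\<Sum>i=1..r. of_nat (k i) * ws i)) ^ m) * t ^ m / fact m) sums
          (\<Sum>\<^sub>\<infinity>k\<in>multi_indices r.
             base_power lu (\<Sum>i=1..r. of_nat (k i) * vs i) *
             exp (q_bracket lq (w + (\<Sum>i=1..r. of_nat (k i) * ws i)) * t))"
      by (intro sums_infsum_times_exp[where B = "(1 + norm (base_power lq w)) / norm (1 - exp lq)"]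
          summable_on_norm_base_power norm_q_bracket_le assms)
    from sums_mult[OF this, of "(1 - exp lu) ^ r"] show ?thesis
      by (simp add: h_def changhee_q_euler_gen_def mult.assoc)
  qed
  have "(THE h. \<forall>t. (\<lambda>m. h m * t ^ m / fact m) sums changhee_q_euler_gen lq lu r w ws vs t) = h"
  proof (rule the_equality)
    fix g assume g: "\<forall>t. (\<lambda>m. g m * t ^ m / fact m) sums changhee_q_euler_gen lq lu r w ws vs t"
    \<comment> \<open>Uniqueness concerns the plain coefficients of \<open>t ^ m\<close>, so it is
      applied to the sequences divided by \<open>fact m\<close>, which then cancels.\<close>
    have "(\<lambda>m. g m / fact m) = (\<lambda>m. h m / fact m)"
      by (rule powser_sums_unique[of _ "changhee_q_euler_gen lq lu r w ws vs"]) (use g h in simp_all)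
    then show "g = h"
      by (simp add: fun_eq_iff)
  qed (use h in blast)
  then show ?thesis
    by (simp add: changhee_q_euler_def h_def)
qed

theorem theorem5:
  fixes q u lq lu w :: complex and ws vs :: "nat \<Rightarrow> complex" and r n :: nat
  assumes "0 < norm q" and "norm q < 1" and "exp lq = q"
    and "u \<noteq> 0" and "algebraic u" and "norm u < 1" and "exp lu = u"
    and "r \<ge> 1"
    and "Re w > 0"
    and "\<And>j. j \<in> {1..r} \<Longrightarrow> Re (ws j) > 0"
    and "\<And>j. j \<in> {1..r} \<Longrightarrow> Re (vs j) > 0"
    and "\<And>j. j \<in> {1..r} \<Longrightarrow> norm (base_power lu (vs j)) < 1"
    and "\<And>j. j \<in> {1..r} \<Longrightarrow> norm (base_power lq (ws j)) < 1"
    and "n > 0"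
  shows "changhee_q_zeta lq lu r (- of_nat n) w ws vs =
         1 / (1 - u) ^ r * changhee_q_euler lq lu r n w ws vs"
proof -
  \<comment> \<open>\<open>norm u < 1\<close> excludes \<open>u = 1\<close>, so
    \<open>(1 - u) ^ r\<close> can be cancelled at the end.\<close>
  have "1 - u \<noteq> 0"
    using assms(6) by auto
  moreover have "changhee_q_euler lq lu r n w ws vs = (1 - u) ^ r *
    (\<Sum>\<^sub>\<infinity>k\<in>multi_indices r.
       base_power lu (\<Sum>i=1..r. of_nat (k i) * vs i) *
       q_bracket lq (w + (\<Sum>i=1..r. of_nat (k i) * ws i)) ^ n)"
    using changhee_q_euler_eq assms(7,12,13) by blast
  moreover have "changhee_q_zeta lq lu r (- of_nat n) w ws vs =
    (\<Sum>\<^sub>\<infinity>k\<in>multi_indices r.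
       base_power lu (\<Sum>i=1..r. of_nat (k i) * vs i) *
       q_bracket lq (w + (\<Sum>i=1..r. of_nat (k i) * ws i)) ^ n)"
    \<comment> \<open>With \<open>n > 0\<close>, a vanishing bracket gives 0 in both forms:
      \<open>0 powr _\<close> and division by 0 are 0, and so is \<open>0 ^ n\<close>. The
      commutation then aligns the order of the factors in the exponent of \<open>u\<close>.\<close>
    unfolding changhee_q_zeta_def divide_powr_minus_of_nat[OF assms(14)]
    by (simp only: mult.commute[of "vs _"])
  ultimately show ?thesis
    by simp
qed

end
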